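(* Suppose $\Sigma$ contains the newline character $\mathtt{\backslash n}$, let $\psi_n\in\Psi$ be a predicate with $[\![\psi_n]\!]=\{\mathtt{\backslash n}\}$, and let $w\in\Psi$ be the predicate denoting the word-letters. Define the following regexes using lookarounds: - $A=\mathtt{(?<!}\top\mathtt{)}$ (start anchor $\mathtt{\backslash A}$); - $Z_0=\mathtt{(?!}\top\mathtt{)}$ (end anchor $\mathtt{\backslash z}$); - $C=A\,\mathtt{|}\,\mathtt{(?<=}\psi_n\mathtt{)}$ (start-of-line anchor); - $E=Z_0\,\mathtt{|}\,\mathtt{(?=}\psi_n\mathtt{)}$ (end-of-line anchor); - $Z=Z_0\,\mathtt{|}\,\mathtt{(?=}\psi_n\cdot Z_0\mathtt{)}$ (anchor $\mathtt{\backslash Z}$); - $b=(\mathtt{(?<=}w\mathtt{)}\cdot\mathtt{(?!}w\mathtt{)})\,\mathtt{|}\,(\mathtt{(?<!}w\mathtt{)}\cdot\mathtt{(?=}w\mathtt{)})$ (word-border anchor $\mathtt{\backslash b}$); - $B=(\mathtt{(?<=}w\mathtt{)}\cdot\mathtt{(?=}w\mathtt{)})\,\mathtt{|}\,(\mathtt{(?<!}w\mathtt{)}\cdot\mathtt{(?!}w\mathtt{)})$ (non-word-border anchor $\mathtt{\backslash B}$). Then these express the standard anchors: for every valid location $x=s\langle i\rangle$, (1) $\mathit{Null}_x(A)\iff i=0$; (2) $\mathit{Null}_x(Z_0)\iff i=|s|$; (3) $\mathit{Null}_x(C)\iff i=0$ or $s_{i-1}=\mathtt{\backslash n}$; (4)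 $\mathit{Null}_x(E)\iff i=|s|$ or $s_i=\mathtt{\backslash n}$; (5) $\mathit{Null}_x(Z)\iff i=|s|$, or $i=|s|-1$ and $s_i=\mathtt{\backslash n}$; (6) $\mathit{Null}_x(b)\iff(s_{i-1}\in[\![w]\!]\Leftrightarrow s_i\notin[\![w]\!])$; (7) $\mathit{Null}_x(B)\iff(s_{i-1}\in[\![w]\!]\Leftrightarrow s_i\in[\![w]\!])$.
   Context: **Alphabet.** $\Sigma$ is a domain of characters, and $(\Sigma,\Psi,[\![\cdot]\!],\bot,\top,\vee,\wedge,\neg)$ is an effective Boolean algebra over $\Sigma$: $\Psi$ is a set of predicates closed under the connectives, $[\![\cdot]\!]:\Psi\to 2^\Sigma$, $[\![\bot]\!]=\emptyset$, $[\![\top]\!]=\Sigma$, $[\![\varphi\vee\psi]\!]=[\![\varphi]\!]\cup[\![\psi]\!]$, $[\![\varphi\wedge\psi]\!]=[\![\varphi]\!]\cap[\![\psi]\!]$, $[\![\neg\varphi]\!]=\Sigma\setminus[\![\varphi]\!]$. The specific set $[\![w]\!]\subseteq\Sigma$ of word-letters is irrelevant for the claim. **Strings and locations.** For $s\in\Sigma^*$, $|s|$ is its length, $s_i$ ($0\le i<|s|$) its $i$-th character (indexing from 0), and $s_{-1}=s_{|s|}=\epsilon$ (the empty string, which belongs to no $[\![\psi]\!]$ and is not equal to any character). $s^r$ is the reverse of $s$. A location in $s$ is a pair $s\langle i\rangle=\langle s,i\rangle$ with $-1\le i\le|s|$; it is valid if $0\le i\le|s|$ and final if $i=|s|$. Locations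 are ordered by position: $s\langle i\rangle<s\langle j\rangle$ iff $i<j$; $s\langle i\rangle+1=s\langle i+1\rangle$. The reverse of a valid location is $s\langle i\rangle^r=s^r\langle|s|-i\rangle$. The match failure is $\mathsf{fail}=\epsilon\langle-1\rangle$, and $\max(x,\mathsf{fail})=\max(\mathsf{fail},x)=x$. **Regexes.** $\mathcal{R}$ is generated by $$R::=\psi\mid()\mid R\,\mathtt{|}\,R'\mid R\,\mathtt{\&}\,R'\mid R\cdot R'\mid R\{m,n\}\mid\ \sim R\mid\mathtt{(?=}R\mathtt{)}\mid\mathtt{(?<=}R\mathtt{)}\mid\mathtt{(?!}R\mathtt{)}\mid\mathtt{(?<!}R\mathtt{)}$$ with $\psi\in\Psi$ and loop bounds $m,n$ satisfying $0\le m\le n\ne0$ with $n$ finite, or $m\geq 0$ finite and $n=\infty$. Convention: $R\{0,0\}=()$. The last four forms (lookahead, lookback, negative lookahead, negative lookback) are called lookarounds. **Reverse of regexes.** $\psi^r=\psi$, $()^r=()$, $(R|S)^r=R^r|S^r$, $(R\&S)^r=R^r\&S^r$, $(R\cdot S)^r=S^r\cdot R^r$, $(R\{m,n\})^r=R^r\{m,n\}$, $(\sim R)^r=\sim(R^r)$, $\mathtt{(?=}R\mathtt{)}^r=\mathtt{(?<=}R^r\mathtt{)}$, $\mathtt{(?<=}R\mathtt{)}^r=\mathtt{(?=}R^r\mathtt{)}$, $\mathtt{(?!}R\mathtt{)}^r=\mathtt{(?<!}R^r\mathtt{)}$, $\mathtt{(?<!}R\mathtt{)}^r=\mathtt{(?!}R^r\mathtt{)}$.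 **Nullability, derivatives, match end** (mutually recursive). For valid $x$: $\mathit{Null}_x(())$ is true; $\mathit{Null}_x(\psi)$ is false; $\mathit{Null}_x(R|R')$ iff $\mathit{Null}_x(R)$ or $\mathit{Null}_x(R')$; $\mathit{Null}_x(R\&R')$ iff $\mathit{Null}_x(R\cdot R')$ iff $\mathit{Null}_x(R)$ and $\mathit{Null}_x(R')$; $\mathit{Null}_x(R\{m,n\})$ iff $m=0$ or $\mathit{Null}_x(R)$; $\mathit{Null}_x(\sim R)$ iff not $\mathit{Null}_x(R)$; $\mathit{Null}_x(\mathtt{(?=}R\mathtt{)})$ iff $\mathit{IsMatch}(x,R)$; $\mathit{Null}_x(\mathtt{(?<=}R\mathtt{)})$ iff $\mathit{IsMatch}(x^r,R^r)$; $\mathit{Null}_x(\mathtt{(?!}R\mathtt{)})$ iff not $\mathit{IsMatch}(x,R)$; $\mathit{Null}_x(\mathtt{(?<!}R\mathtt{)})$ iff not $\mathit{IsMatch}(x^r,R^r)$. $\mathit{Null}_\forall(R)$ means that $\mathit{Null}_x(R)$ is true for all valid $x$ (in all strings). For valid nonfinal $x=s\langle i\rangle$ the derivative $\partial_x(R)\in\mathcal{R}$ is: $\partial_x(())=\bot$; $\partial_x(\ell)=\bot$ for lookarounds $\ell$; $\partial_{s\langle i\rangle}(\psi)=()$ if $s_i\in[\![\psi]\!]$, else $\bot$; $\partial_x(R|S)=\partial_x(R)|\partial_x(S)$; $\partial_x(R\&S)=\partial_x(R)\&\partial_x(S)$; $\partial_x(\sim R)=\sim\partial_x(R)$; $\partial_x(R\cdot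 S)=(\partial_x(R)\cdot S)\,|\,\partial_x(S)$ if $\mathit{Null}_x(R)$, else $\partial_x(R)\cdot S$; $\partial_x(R\{m,n\})=\partial_x(R)\cdot R\{m\dot-1,n\dot-1\}$ if $m=0$ or $\mathit{Null}_\forall(R)$ or not $\mathit{Null}_x(R)$, else $\partial_x(R\cdot R\{m\dot-1,n\dot-1\})$. Here $\infty\dot-1=\infty$, $0\dot-1=0$, $k\dot-1=k-1$ for $k>0$. $\mathit{Null}^{\mathsf{fail}}_x(R)=x$ if $\mathit{Null}_x(R)$, else $\mathsf{fail}$. $\mathit{MatchEnd}(x,R)=\mathit{Null}^{\mathsf{fail}}_x(R)$ if $x$ is final, else $\max(\mathit{Null}^{\mathsf{fail}}_x(R),\mathit{MatchEnd}(x+1,\partial_x(R)))$. $\mathit{IsMatch}(x,R)$ iff $\mathit{MatchEnd}(x,R)\ne\mathsf{fail}$. *)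

theory Defs
  imports Main "HOL-Library.Extended_Nat"
begin

section \<open>Alphabets\<close>

text \<open>The carriers \<open>\<Psi>\<close> and \<open>\<Sigma>\<close> are the types \<open>'p\<close> and \<open>'c\<close>.\<close>

record ('p, 'c) pred_algebra =
  den :: "'p \<Rightarrow> 'c set"
  pbot :: 'p
  ptop :: 'p
  por :: "'p \<Rightarrow> 'p \<Rightarrow> 'p"
  pand :: "'p \<Rightarrow> 'p \<Rightarrow> 'p"
  pnot :: "'p \<Rightarrow> 'p"

locale effective_boolean_algebra =
  fixes \<A> :: "('p, 'c) pred_algebra"
  assumes den_bot: "den \<A> (pbot \<A>) = {}"
    and den_top: "den \<A> (ptop \<A>) = UNIV"
    and den_or: "den \<A> (por \<A> \<phi> \<psi>) = den \<A> \<phi> \<union> den \<A> \<psi>"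
    and den_and: "den \<A> (pand \<A> \<phi> \<psi>) = den \<A> \<phi> \<inter> den \<A> \<psi>"
    and den_not: "den \<A> (pnot \<A> \<phi>) = UNIV - den \<A> \<phi>"

section \<open>Strings and locations\<close>

text \<open>\<open>None\<close> plays the role of the empty string, the value of \<open>s\<^sub>-\<^sub>1\<close> and \<open>s\<^bsub>|s|\<^esub>\<close>;
  \<open>s\<^sub>i \<in> X\<close> is accordingly written \<open>char_at s i \<in> Some ` X\<close>.\<close>

definition char_at :: "'c list \<Rightarrow> int \<Rightarrow> 'c option" where
  "char_at s i = (if 0 \<le> i \<and> i < int (length s) then Some (s ! nat i) else None)"

type_synonym 'c loc = "'c list \<times> int"

definition valid :: "'c loc \<Rightarrow> bool" where
  "valid x \<longleftrightarrow> 0 \<le> snd x \<and> snd x \<le> int (length (fst x))"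

definition final :: "'c loc \<Rightarrow> bool" where
  "final x \<longleftrightarrow> snd x = int (length (fst x))"

definition next_loc :: "'c loc \<Rightarrow> 'c loc" where
  "next_loc x = (fst x, snd x + 1)"

definition rev_loc :: "'c loc \<Rightarrow> 'c loc" where
  "rev_loc x = (rev (fst x), int (length (fst x)) - snd x)"

definition fail :: "'c loc" where
  "fail = ([], -1)"

definition max_loc :: "'c loc \<Rightarrow> 'c loc \<Rightarrow> 'c loc" where
  "max_loc x y =
    (if y = fail then x else if x = fail then y else if snd x \<le> snd y then y else x)"

section \<open>Regexes\<close>

typedef bounds = "{(m :: nat, n :: enat). enat m \<le> n \<and> n \<noteq> 0}"
  by (rule exI[of _ "(0, \<infinity>)"]) simp

definition lo :: "bounds \<Rightarrow> nat" where
  "lo b = fst (Rep_bounds b)"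

definition hi :: "bounds \<Rightarrow> enat" where
  "hi b = snd (Rep_bounds b)"

datatype 'p regex =
    Pred 'p
  | Eps
  | Alt "'p regex" "'p regex"
  | Conj "'p regex" "'p regex"
  | Cat "'p regex" "'p regex"
  | Loop "'p regex" bounds
  | Compl "'p regex"
  | LookAhead "'p regex"
  | LookBack "'p regex"
  | NegLookAhead "'p regex"
  | NegLookBack "'p regex"

text \<open>\<open>R{m,n}\<close> for \<open>m \<le> n\<close>, with the convention \<open>R{0,0} = ()\<close>.\<close>

definition loop :: "'p regex \<Rightarrow> nat \<Rightarrow> enat \<Rightarrow> 'p regex" where
  "loop R m n = (if n = 0 then Eps else Loop R (Abs_bounds (m, n)))"

text \<open>\<open>R{m-1,n-1}\<close> for the loop \<open>R{m,n}\<close> with bounds \<open>b\<close>. Subtraction on \<^typ>\<open>nat\<close> and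
  \<^typ>\<open>enat\<close> is truncated and satisfies \<open>\<infinity> - 1 = \<infinity>\<close>.\<close>

definition loop_pred :: "'p regex \<Rightarrow> bounds \<Rightarrow> 'p regex" where
  "loop_pred R b = loop R (lo b - 1) (hi b - 1)"

primrec rev_regex :: "'p regex \<Rightarrow> 'p regex" where
  "rev_regex (Pred \<psi>) = Pred \<psi>"
| "rev_regex Eps = Eps"
| "rev_regex (Alt R S) = Alt (rev_regex R) (rev_regex S)"
| "rev_regex (Conj R S) = Conj (rev_regex R) (rev_regex S)"
| "rev_regex (Cat R S) = Cat (rev_regex S) (rev_regex R)"
| "rev_regex (Loop R b) = Loop (rev_regex R) b"
| "rev_regex (Compl R) = Compl (rev_regex R)"
| "rev_regex (LookAhead R) = LookBack (rev_regex R)"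
| "rev_regex (LookBack R) = LookAhead (rev_regex R)"
| "rev_regex (NegLookAhead R) = NegLookBack (rev_regex R)"
| "rev_regex (NegLookBack R) = NegLookAhead (rev_regex R)"

section \<open>Nullability, derivatives and match end\<close>

text \<open>Two measures for the termination proof: the nesting depth of lookarounds, and a size
  in which \<open>R\<cdot>R{m-1,n-1}\<close> is smaller than \<open>R{m,n}\<close> if \<open>m > 0\<close>.\<close>

primrec look_depth :: "'p regex \<Rightarrow> nat" where
  "look_depth (Pred \<psi>) = 0"
| "look_depth Eps = 0"
| "look_depth (Alt R S) = max (look_depth R) (look_depth S)"
| "look_depth (Conj R S) = max (look_depth R) (look_depth S)"
| "look_depth (Cat R S) = max (look_depth R) (look_depth S)"
| "look_depth (Loop R b) = look_depth R"
| "look_depth (Compl R) = look_depth R"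
| "look_depth (LookAhead R) = Suc (look_depth R)"
| "look_depth (LookBack R) = Suc (look_depth R)"
| "look_depth (NegLookAhead R) = Suc (look_depth R)"
| "look_depth (NegLookBack R) = Suc (look_depth R)"

primrec unfold_size :: "'p regex \<Rightarrow> nat" where
  "unfold_size (Pred \<psi>) = 1"
| "unfold_size Eps = 1"
| "unfold_size (Alt R S) = unfold_size R + unfold_size S + 1"
| "unfold_size (Conj R S) = unfold_size R + unfold_size S + 1"
| "unfold_size (Cat R S) = unfold_size R + unfold_size S + 1"
| "unfold_size (Loop R b) = (unfold_size R + 2) * (lo b + 1)"
| "unfold_size (Compl R) = unfold_size R + 1"
| "unfold_size (LookAhead R) = unfold_size R + 1"
| "unfold_size (LookBack R) = unfold_size R + 1"
| "unfold_size (NegLookAhead R) = unfold_size R + 1"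
| "unfold_size (NegLookBack R) = unfold_size R + 1"

lemma look_depth_rev_regex [simp]: "look_depth (rev_regex R) = look_depth R"
  by (induction R) auto

lemma bounds_le: "enat (lo b) \<le> hi b"
  using Rep_bounds[of b] by (auto simp: lo_def hi_def)

lemma lo_Abs_bounds: "enat m \<le> n \<Longrightarrow> n \<noteq> 0 \<Longrightarrow> lo (Abs_bounds (m, n)) = m"
  by (simp add: lo_def Abs_bounds_inverse)

lemma look_depth_loop_pred: "look_depth (loop_pred R b) \<le> look_depth R"
  by (simp add: loop_pred_def loop_def)

lemma bounds_pred_le: "enat (lo b - 1) \<le> hi b - 1"
proof (cases "hi b")
  case (enat n)
  then show ?thesis using bounds_le[of b] by (simp add: one_enat_def)
next
  case infinity
  then show ?thesis by simp
qed

lemma unfold_size_loop_pred: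
  assumes "lo b \<noteq> 0"
  shows "unfold_size (Cat R (loop_pred R b)) < unfold_size (Loop R b)"
proof -
  obtain m where m: "lo b = Suc m" using assms not0_implies_Suc by blast
  have "unfold_size (loop_pred R b) \<le> (unfold_size R + 2) * (m + 1)"
    using bounds_pred_le[of b] m by (auto simp: loop_pred_def loop_def lo_Abs_bounds)
  then show ?thesis using m by simp
qed

text \<open>All functions are total; outside their intended domain (valid locations, for \<open>deriv\<close>
  nonfinal ones) their values carry no meaning. The clause for \<open>MatchEnd\<close> therefore
  recurses at valid nonfinal locations only.\<close>

context
  fixes \<A> :: "('p, 'c) pred_algebra"
begin

function (sequential)
  Null :: "'c loc \<Rightarrow> 'p regex \<Rightarrow> bool"
  and NullAll :: "'p regex \<Rightarrow> bool"
  and deriv :: "'c loc \<Rightarrow> 'p regex \<Rightarrow> 'p regex"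
  and NullFail :: "'c loc \<Rightarrow> 'p regex \<Rightarrow> 'c loc"
  and MatchEnd :: "'c loc \<Rightarrow> 'p regex \<Rightarrow> 'c loc"
  and IsMatch :: "'c loc \<Rightarrow> 'p regex \<Rightarrow> bool"
where
  "Null x Eps \<longleftrightarrow> True"
| "Null x (Pred \<psi>) \<longleftrightarrow> False"
| "Null x (Alt R S) \<longleftrightarrow> Null x R \<or> Null x S"
| "Null x (Conj R S) \<longleftrightarrow> Null x R \<and> Null x S"
| "Null x (Cat R S) \<longleftrightarrow> Null x R \<and> Null x S"
| "Null x (Loop R b) \<longleftrightarrow> lo b = 0 \<or> Null x R"
| "Null x (Compl R) \<longleftrightarrow> \<not> Null x R"
| "Null x (LookAhead R) \<longleftrightarrow> IsMatch x R"
| "Null x (LookBack R) \<longleftrightarrow> IsMatch (rev_loc x) (rev_regex R)"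
| "Null x (NegLookAhead R) \<longleftrightarrow> \<not> IsMatch x R"
| "Null x (NegLookBack R) \<longleftrightarrow> \<not> IsMatch (rev_loc x) (rev_regex R)"

| "NullAll R \<longleftrightarrow> (\<forall>x. valid x \<longrightarrow> Null x R)"

| "deriv x Eps = Pred (pbot \<A>)"
| "deriv x (Pred \<psi>) =
    (if char_at (fst x) (snd x) \<in> Some ` den \<A> \<psi> then Eps else Pred (pbot \<A>))"
| "deriv x (Alt R S) = Alt (deriv x R) (deriv x S)"
| "deriv x (Conj R S) = Conj (deriv x R) (deriv x S)"
| "deriv x (Cat R S) =
    (if Null x R then Alt (Cat (deriv x R) S) (deriv x S) else Cat (deriv x R) S)"
| "deriv x (Loop R b) =
    (if lo b = 0 \<or> NullAll R \<or> \<not> Null x R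
     then Cat (deriv x R) (loop_pred R b)
     else deriv x (Cat R (loop_pred R b)))"
| "deriv x (Compl R) = Compl (deriv x R)"
| "deriv x (LookAhead R) = Pred (pbot \<A>)"
| "deriv x (LookBack R) = Pred (pbot \<A>)"
| "deriv x (NegLookAhead R) = Pred (pbot \<A>)"
| "deriv x (NegLookBack R) = Pred (pbot \<A>)"

| "NullFail x R = (if Null x R then x else fail)"

| "MatchEnd x R =
    (if valid x \<and> \<not> final x
     then max_loc (NullFail x R) (MatchEnd (next_loc x) (deriv x R))
     else NullFail x R)"

| "IsMatch x R \<longleftrightarrow> MatchEnd x R \<noteq> fail"
  by pat_completeness auto

lemma look_depth_deriv:
  assumes "Null_NullAll_deriv_NullFail_MatchEnd_IsMatch_dom (Inl (Inr (Inr (x, R))))"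
  shows "look_depth (deriv x R) \<le> look_depth R"
  using assms
proof (induction x R rule: Null_NullAll_deriv_NullFail_MatchEnd_IsMatch.pinduct(3)
    [where ?P1.0 = "\<lambda>_ _. True" and ?P2.0 = "\<lambda>_. True" and ?P4.0 = "\<lambda>_ _. True"
       and ?P5.0 = "\<lambda>_ _. True" and ?P6.0 = "\<lambda>_ _. True"])
  case (17 x R S)
  then show ?case
    by (cases "Null x R") (auto simp: deriv.psimps max_def)
qed (auto simp: deriv.psimps le_max_iff_disj look_depth_loop_pred
    intro: order_trans[OF look_depth_loop_pred])

termination
proof (relation "measures
    [case_sum
       (case_sum (\<lambda>(x, R). look_depth R) (case_sum look_depth (\<lambda>(x, R). look_depth R)))
       (case_sum (\<lambda>(x, R). look_depth R)
         (case_sum (\<lambda>(x, R). look_depth R) (\<lambda>(x, R). look_depth R))),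
     case_sum
       (case_sum (\<lambda>_. 0) (case_sum (\<lambda>_. 1) (\<lambda>_. 2)))
       (case_sum (\<lambda>_. 1) (case_sum (\<lambda>_. 3) (\<lambda>_. 4))),
     case_sum
       (case_sum (\<lambda>_. 0) (\<lambda>_. 0))
       (case_sum (\<lambda>_. 0) (case_sum (\<lambda>(x, R). nat (int (length (fst x)) - snd x)) (\<lambda>_. 0))),
     case_sum
       (case_sum (\<lambda>(x, R). unfold_size R)
         (case_sum unfold_size (\<lambda>(x, R). unfold_size R)))
       (\<lambda>_. 0)]", goal_cases)
  case (26 x R b)
  then show ?case
    using look_depth_loop_pred[of R b] unfold_size_loop_pred[of b R] by auto
next
  case (31 x R)
  then show ?case
    using look_depth_deriv[of x R] by (auto simp: next_loc_def valid_def final_def)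
qed (auto simp: less_max_iff_disj max_def)

end

declare MatchEnd.simps [simp del]

section \<open>Anchors\<close>

definition start_anchor :: "('p, 'c) pred_algebra \<Rightarrow> 'p regex" where
  "start_anchor \<A> = NegLookBack (Pred (ptop \<A>))"

definition end_anchor :: "('p, 'c) pred_algebra \<Rightarrow> 'p regex" where
  "end_anchor \<A> = NegLookAhead (Pred (ptop \<A>))"

definition line_start_anchor :: "('p, 'c) pred_algebra \<Rightarrow> 'p \<Rightarrow> 'p regex" where
  "line_start_anchor \<A> \<psi>n = Alt (start_anchor \<A>) (LookBack (Pred \<psi>n))"

definition line_end_anchor :: "('p, 'c) pred_algebra \<Rightarrow> 'p \<Rightarrow> 'p regex" where
  "line_end_anchor \<A> \<psi>n = Alt (end_anchor \<A>) (LookAhead (Pred \<psi>n))"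

definition last_line_end_anchor :: "('p, 'c) pred_algebra \<Rightarrow> 'p \<Rightarrow> 'p regex" where
  "last_line_end_anchor \<A> \<psi>n =
    Alt (end_anchor \<A>) (LookAhead (Cat (Pred \<psi>n) (end_anchor \<A>)))"

definition word_border_anchor :: "'p \<Rightarrow> 'p regex" where
  "word_border_anchor w =
    Alt (Cat (LookBack (Pred w)) (NegLookAhead (Pred w)))
        (Cat (NegLookBack (Pred w)) (LookAhead (Pred w)))"

definition non_word_border_anchor :: "'p \<Rightarrow> 'p regex" where
  "non_word_border_anchor w =
    Alt (Cat (LookBack (Pred w)) (LookAhead (Pred w)))
        (Cat (NegLookBack (Pred w)) (NegLookAhead (Pred w)))"

end

(* A pattern starting with a single predicate can match only by consuming the next character,
   so lookarounds around such a pattern inspect the characters adjacent to the location;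
   reversing the location turns the preceding character into the next one. *)
theory Submission
  imports Defs
begin

declare IsMatch.simps [simp del]

lemma max_loc_eq_fail_iff: "max_loc x y = fail \<longleftrightarrow> x = fail \<and> y = fail"
  by (auto simp: max_loc_def)

lemma valid_next_loc: "valid x \<Longrightarrow> \<not> final x \<Longrightarrow> valid (next_loc x)"
  by (auto simp: valid_def final_def next_loc_def)

lemma valid_rev_loc: "valid x \<Longrightarrow> valid (rev_loc x)"
  by (auto simp: valid_def rev_loc_def)

text \<open>Induction on the number of characters still to be read. The hypothesis is guarded by
  nonfinality, just as the recursion of \<open>MatchEnd\<close> is.\<close>

lemma valid_loc_induct [consumes 1, case_names step]:
  assumes "valid x"
    and step: "\<And>x. valid x \<Longrightarrow> (\<not> final x \<Longrightarrow> P (next_loc x)) \<Longrightarrow> P x"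
  shows "P x"
  using assms(1)
proof (induction "nat (int (length (fst x)) - snd x)" arbitrary: x rule: less_induct)
  case less
  show ?case
  proof (rule step[OF less.prems])
    assume "\<not> final x"
    with less show "P (next_loc x)"
      by (intro less.hyps valid_next_loc) (auto simp: valid_def final_def next_loc_def)
  qed
qed

text \<open>\<open>fail\<close> sits at position -1, so no valid location equals it, and a maximum
  is \<open>fail\<close> only if both arguments are. Match ends thus drop out, leaving a one-step
  recursion. Instantiated at a fixed \<open>x\<close>, it unfolds once and stops at
  \<open>next_loc x\<close>.\<close>

lemma IsMatch_rec:
  assumes "valid x"
  shows "IsMatch \<A> x R \<longleftrightarrow>
    Null \<A> x R \<or> \<not> final x \<and> IsMatch \<A> (next_loc x) (deriv \<A> x R)"
proof -
  have "x \<noteq> fail"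
    using assms by (auto simp: valid_def fail_def)
  then show ?thesis
    using assms by (auto simp: IsMatch.simps MatchEnd.simps[of \<A> x R] max_loc_eq_fail_iff)
qed

lemma IsMatch_Eps: "valid x \<Longrightarrow> IsMatch \<A> x Eps"
  by (simp add: IsMatch_rec)

lemma IsMatch_Alt:
  assumes "valid x"
  shows "IsMatch \<A> x (Alt R S) \<longleftrightarrow> IsMatch \<A> x R \<or> IsMatch \<A> x S"
  using assms
\<comment> \<open>Both alternatives are generalized, since the next location meets their
  derivatives.\<close>
proof (induction x arbitrary: R S rule: valid_loc_induct)
  case (step x)
  then show ?case
    by (auto simp: IsMatch_rec[of x])
qed

lemma char_at_final: "final x \<Longrightarrow> char_at (fst x) (snd x) = None"
  by (simp add: final_def char_at_def)

lemma char_at_rev_loc: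
  assumes "valid x"
  shows "char_at (fst (rev_loc x)) (snd (rev_loc x)) = char_at (fst x) (snd x - 1)"
proof (cases "snd x = 0")
  \<comment> \<open>Both sides are \<open>None\<close>: one position is past the end of the reversed
    string, the other is -1.\<close>
  case True
  then show ?thesis by (simp add: rev_loc_def char_at_def)
next
  case False
  with assms have "0 < snd x" "snd x \<le> int (length (fst x))"
    by (auto simp: valid_def)
  \<comment> \<open>The left-hand side is the index that \<open>rev_nth\<close> produces for the
    reversed string.\<close>
  moreover from this have
    "length (fst x) - Suc (nat (int (length (fst x)) - snd x)) = nat (snd x - 1)"
    by linarith
  ultimately show ?thesis
    by (simp add: rev_loc_def char_at_def rev_nth nat_less_iff)
qed

context effective_boolean_algebra
begin

text \<open>The bottom predicate is never nullable and is its own derivative, so no later location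
  helps.\<close>

lemma not_IsMatch_bot:
  assumes "valid x"
  shows "\<not> IsMatch \<A> x (Pred (pbot \<A>))"
  using assms
proof (induction x rule: valid_loc_induct)
  case (step x)
  then show ?case
    by (auto simp: IsMatch_rec[of x] den_bot)
qed

lemma not_IsMatch_Cat_bot:
  assumes "valid x"
  shows "\<not> IsMatch \<A> x (Cat (Pred (pbot \<A>)) R)"
  using assms
proof (induction x rule: valid_loc_induct)
  case (step x)
  then show ?case
    by (auto simp: IsMatch_rec[of x] den_bot)
qed

lemma IsMatch_Pred:
  assumes "valid x"
  shows "IsMatch \<A> x (Pred \<psi>) \<longleftrightarrow> char_at (fst x) (snd x) \<in> Some ` den \<A> \<psi>"
  using assms
  by (cases "final x") (auto simp: char_at_final IsMatch_rec[of x] IsMatch_Eps not_IsMatch_bot valid_next_loc)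

text \<open>As \<open>Eps\<close> is nullable, the derivative is an alternative whose left branch
  starts with bottom and is dead; its right branch is the derivative of \<open>R\<close>.\<close>

lemma IsMatch_Cat_Eps:
  assumes "valid x"
  shows "IsMatch \<A> x (Cat Eps R) \<longleftrightarrow> IsMatch \<A> x R"
  using assms
  by (auto simp: IsMatch_rec[of x] IsMatch_Alt not_IsMatch_Cat_bot valid_next_loc)

text \<open>One derivative leaves \<open>Eps\<close> or bottom in front of \<open>R\<close>. At a
  final location the character is \<open>None\<close>, so it does not matter that
  \<open>next_loc x\<close> is invalid.\<close>

lemma IsMatch_Cat_Pred:
  assumes "valid x"
  shows "IsMatch \<A> x (Cat (Pred \<psi>) R) \<longleftrightarrow>
    char_at (fst x) (snd x) \<in> Some ` den \<A> \<psi> \<and> IsMatch \<A> (next_loc x) R"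
  using assms
  by (cases "final x") (auto simp: char_at_final IsMatch_rec[of x] IsMatch_Cat_Eps not_IsMatch_Cat_bot valid_next_loc)

text \<open>A lookaround has derivative bottom, so it can only match emptily at \<open>x\<close>
  itself. This handles the end anchor nested inside a lookahead.\<close>

lemma IsMatch_NegLookAhead:
  assumes "valid x"
  shows "IsMatch \<A> x (NegLookAhead R) \<longleftrightarrow> \<not> IsMatch \<A> x R"
  using assms
  by (cases "final x")
    (auto simp: IsMatch_rec[of x _ "NegLookAhead R"] not_IsMatch_bot valid_next_loc)

lemma IsMatch_rev_loc_Pred:
  assumes "valid x"
  shows "IsMatch \<A> (rev_loc x) (Pred \<psi>) \<longleftrightarrow>
    char_at (fst x) (snd x - 1) \<in> Some ` den \<A> \<psi>"
  using assms by (simp only: IsMatch_Pred valid_rev_loc char_at_rev_loc)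

end

theorem mainTheorem5:
  fixes \<A> :: "('p, 'c) pred_algebra"
    and newline :: 'c
    and \<psi>n w :: 'p
    and s :: "'c list"
    and i :: int
  assumes "effective_boolean_algebra \<A>"
    and "den \<A> \<psi>n = {newline}"
    and "valid (s, i)"
  shows "(Null \<A> (s, i) (start_anchor \<A>) \<longleftrightarrow> i = 0) \<and>
    (Null \<A> (s, i) (end_anchor \<A>) \<longleftrightarrow> i = int (length s)) \<and>
    (Null \<A> (s, i) (line_start_anchor \<A> \<psi>n) \<longleftrightarrow>
       i = 0 \<or> char_at s (i - 1) = Some newline) \<and>
    (Null \<A> (s, i) (line_end_anchor \<A> \<psi>n) \<longleftrightarrow>
       i = int (length s) \<or> char_at s i = Some newline) \<and>
    (Null \<A> (s, i) (last_line_end_anchor \<A> \<psi>n) \<longleftrightarrow>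
       i = int (length s) \<or> (i = int (length s) - 1 \<and> char_at s i = Some newline)) \<and>
    (Null \<A> (s, i) (word_border_anchor w) \<longleftrightarrow>
       (char_at s (i - 1) \<in> Some ` den \<A> w \<longleftrightarrow> char_at s i \<notin> Some ` den \<A> w)) \<and>
    (Null \<A> (s, i) (non_word_border_anchor w) \<longleftrightarrow>
       (char_at s (i - 1) \<in> Some ` den \<A> w \<longleftrightarrow> char_at s i \<in> Some ` den \<A> w))"
proof -
  interpret effective_boolean_algebra \<A> by fact
  note [simp] = IsMatch_Pred IsMatch_rev_loc_Pred den_top \<open>valid (s, i)\<close> \<open>den \<A> \<psi>n = {newline}\<close>
  have bnd: "0 \<le> i" "i \<le> int (length s)"
    using \<open>valid (s, i)\<close> by (simp_all add: valid_def)
  \<comment> \<open>By \<open>den_top\<close>, testing a neighbour against the top predicate is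
    membership in \<open>range Some\<close>: it asks only whether that character exists.\<close>
  have prev: "char_at s (i - 1) \<in> range Some \<longleftrightarrow> i \<noteq> 0"
    and "next": "char_at s i \<in> range Some \<longleftrightarrow> i \<noteq> int (length s)"
    using bnd by (auto simp: char_at_def)
  have A: "Null \<A> (s, i) (start_anchor \<A>) \<longleftrightarrow> i = 0"
    using prev by (simp add: start_anchor_def)
  have Z0: "Null \<A> (s, i) (end_anchor \<A>) \<longleftrightarrow> i = int (length s)"
    using "next" by (simp add: end_anchor_def)
  have Z: "IsMatch \<A> (s, i) (Cat (Pred \<psi>n) (end_anchor \<A>)) \<longleftrightarrow>
      i = int (length s) - 1 \<and> char_at s i = Some newline"
  \<comment> \<open>A newline at \<open>i\<close> forces \<open>i\<close> below the length, so
    \<open>i + 1\<close> is valid and the end anchor can be evaluated there.\<close>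
  proof (cases "char_at s i = Some newline")
    case True
    then have "i < int (length s)"
      by (simp add: char_at_def split: if_splits)
    with bnd have "valid (s, i + 1)"
      and "char_at s (i + 1) \<in> range Some \<longleftrightarrow> i \<noteq> int (length s) - 1"
      by (auto simp: valid_def char_at_def)
    with True show ?thesis
      by (simp add: IsMatch_Cat_Pred end_anchor_def IsMatch_NegLookAhead next_loc_def)
  next
    case False
    then show ?thesis by (simp add: IsMatch_Cat_Pred)
  qed
  show ?thesis
    \<comment> \<open>What remains is propositional: nullability of \<open>Alt\<close> and
      \<open>Cat\<close> is disjunction and conjunction of facts about the two neighbouring
      characters.\<close>
    unfolding line_start_anchor_def line_end_anchor_def last_line_end_anchor_def
      word_border_anchor_def non_word_border_anchor_def
    by (auto simp: A Z0 Z)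
qed

end
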